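(* Let $(\mathfrak{M},g,f)$ be a manifold of $B$-type. Then the coefficients $\Gamma^\sigma_{\alpha\beta}$ (in adapted coordinates) of the Riemannian (Levi-Civita) connection of $g$ are pure with respect to all indices if and only if the partial derivatives $\partial_\sigma g_{\alpha\beta}=\frac{\partial}{\partial z^\sigma}g_{\alpha\beta}$ (in adapted coordinates) are pure toward $f$.
   Context: Setting. $\mathfrak{M}$ is a smooth manifold of dimension $2n+m$ with a fixed atlas of adapted coordinates $(z^i,z^{n+i},z^{2n+a})$, $i=1,\dots,n$, $a=1,\dots,m$, whose coordinate changes have the form $z^i=\varphi^i(\bar z^1,\dots,\bar z^n)$, $z^{n+i}=\sum_k \frac{\partial\varphi^i}{\partial\bar z^k}\bar z^{n+k}$, $z^{2n+a}=\Theta^a(\bar z^1,\dots,\bar z^n;\bar z^{2n+1},\dots,\bar z^{2n+m})$. The tensor field $f$ of type $(1,1)$ is given in every adapted chart by the constant components $f^{n+i}_{k}=\delta^i_k$ ($i,k=1,\dots,n$), all other components zero; so $f^2=0$. Greek indices run over $1,\dots,2n+m$ and repeated indices are summed. A (pseudo-)Riemannian metric $g$ on $\mathfrak{M}$ (symmetric, nondegenerate, of any signature) makes $(\mathfrak{M},g,f)$ a manifold of $B$-type if $g(fx,y)=g(x,fy)$ for all vector fields $x,y$. Connection coefficients $\Gamma^\alpha_{\beta\sigma}$ are pure with respect to all indices if $\Gamma^\lambda_{\beta\sigma}f^\alpha_\lambda=\Gamma^\alpha_{\beta\lambda}f^\lambda_\sigma=\Gamma^\alpha_{\lambda\sigma}f^\lambda_\beta$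 for all $\alpha,\beta,\sigma$. The partial derivatives $\partial_\sigma g_{\alpha\beta}$ are pure toward $f$ if $f^\lambda_\sigma\,\partial_\lambda g_{\alpha\beta}=f^\lambda_\alpha\,\partial_\sigma g_{\lambda\beta}=f^\lambda_\beta\,\partial_\sigma g_{\alpha\lambda}$ for all $\alpha,\beta,\sigma$. *)

theory Defs
  imports "HOL-Analysis.Analysis"
begin

section \<open>Calculus on open subsets of coordinate space\<close>

text \<open>\<open>smooth_on S h\<close>, meant for open \<open>S\<close>: \<open>h\<close> is infinitely often Frechet differentiable on \<open>S\<close>.
  The definition is coinductive: \<open>h\<close> is differentiable at every point of \<open>S\<close> and each of its
  directional derivatives is again smooth on \<open>S\<close>.\<close>

coinductive smooth_on ::
    "'a::real_normed_vector set \<Rightarrow> ('a \<Rightarrow> 'b::real_normed_vector) \<Rightarrow> bool" where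
  "\<lbrakk>\<And>x. x \<in> S \<Longrightarrow> (h has_derivative h' x) (at x); \<And>v. smooth_on S (\<lambda>x. h' x v)\<rbrakk>
    \<Longrightarrow> smooth_on S h"

definition pd :: "'d::finite \<Rightarrow> (real^'d \<Rightarrow> real) \<Rightarrow> real^'d \<Rightarrow> real" where
  "pd k h x = deriv (\<lambda>t. h (x + t *\<^sub>R axis k 1)) 0"

section \<open>Smooth manifolds\<close>

text \<open>A chart is a pair of its domain and its coordinate map; only the values of the coordinate map
  on the domain matter. The coordinate index type \<open>'d\<close> plays the role of the range of the Greek
  indices.\<close>

type_synonym ('p, 'd) chart = "'p set \<times> ('p \<Rightarrow> real^'d)"

abbreviation dom_of :: "('p, 'd) chart \<Rightarrow> 'p set" where
  "dom_of c \<equiv> fst c"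

abbreviation crd :: "('p, 'd) chart \<Rightarrow> 'p \<Rightarrow> real^'d" where
  "crd c \<equiv> snd c"

definition point_of :: "('p, 'd) chart \<Rightarrow> real^'d \<Rightarrow> 'p" where
  "point_of c = inv_into (dom_of c) (crd c)"

definition is_chart :: "'p topology \<Rightarrow> ('p, 'd::finite) chart \<Rightarrow> bool" where
  "is_chart M c \<longleftrightarrow> openin M (dom_of c) \<and> open (crd c ` dom_of c) \<and>
     homeomorphic_map (subtopology M (dom_of c)) (top_of_set (crd c ` dom_of c)) (crd c)"

text \<open>\<open>transition b c\<close> expresses the \<open>c\<close>-coordinates as functions of the \<open>b\<close>-coordinates; it is
  meaningful on \<open>overlap b c\<close>, the image of the common domain in the \<open>b\<close>-coordinates.\<close>

definition transition :: "('p, 'd) chart \<Rightarrow> ('p, 'd) chart \<Rightarrow> real^'d \<Rightarrow> real^'d" where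
  "transition b c x = crd c (point_of b x)"

definition overlap :: "('p, 'd) chart \<Rightarrow> ('p, 'd) chart \<Rightarrow> (real^'d) set" where
  "overlap b c = crd b ` (dom_of b \<inter> dom_of c)"

definition smooth_manifold :: "'p topology \<Rightarrow> ('p, 'd::finite) chart set \<Rightarrow> bool" where
  "smooth_manifold M A \<longleftrightarrow>
     Hausdorff_space M \<and> second_countable M \<and>
     (\<forall>c\<in>A. is_chart M c) \<and> (\<Union>c\<in>A. dom_of c) = topspace M \<and>
     (\<forall>b\<in>A. \<forall>c\<in>A. smooth_on (overlap b c) (transition b c))"

section \<open>Adapted atlases\<close>

definition depends_only_on :: "'d set \<Rightarrow> (real^'d \<Rightarrow> real) \<Rightarrow> bool" where
  "depends_only_on K h \<longleftrightarrow> (\<forall>x y. (\<forall>k\<in>K. x $ k = y $ k) \<longrightarrow> h x = h y)"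

text \<open>The numbering \<open>ix\<close> identifies \<open>{1..2*n+m}\<close> with the index type, so that \<open>z $ ix \<alpha>\<close> is the
  coordinate \<open>z\<close> with upper index \<open>\<alpha>\<close>. Functions of some of the coordinates are rendered as functions
  of all coordinates that depend only on those; smoothness of \<open>\<phi>\<close> and \<open>\<Theta>\<close> on the overlap follows from
  smoothness of the transition map.\<close>

definition adapted_change ::
    "nat \<Rightarrow> nat \<Rightarrow> (nat \<Rightarrow> 'd::finite) \<Rightarrow> ('p, 'd) chart \<Rightarrow> ('p, 'd) chart \<Rightarrow> bool" where
  "adapted_change n m ix b c \<longleftrightarrow>
     (\<exists>\<phi> \<Theta>. (\<forall>i\<in>{1..n}. depends_only_on (ix ` {1..n}) (\<phi> i)) \<and>
            (\<forall>a\<in>{1..m}. depends_only_on (ix ` ({1..n} \<union> {2*n+1..2*n+m})) (\<Theta> a)) \<and>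
            (\<forall>w\<in>overlap b c.
               (\<forall>i\<in>{1..n}. transition b c w $ ix i = \<phi> i w) \<and>
               (\<forall>i\<in>{1..n}. transition b c w $ ix (n + i) =
                             (\<Sum>k=1..n. pd (ix k) (\<phi> i) w * w $ ix (n + k))) \<and>
               (\<forall>a\<in>{1..m}. transition b c w $ ix (2*n + a) = \<Theta> a w)))"

definition adapted_manifold ::
    "nat \<Rightarrow> nat \<Rightarrow> (nat \<Rightarrow> 'd::finite) \<Rightarrow> 'p topology \<Rightarrow> ('p, 'd) chart set \<Rightarrow> bool" where
  "adapted_manifold n m ix M A \<longleftrightarrow>
     bij_betw ix {1..2*n+m} UNIV \<and> smooth_manifold M A \<and>
     (\<forall>b\<in>A. \<forall>c\<in>A. adapted_change n m ix b c)"

text \<open>The component matrix of the affinor \<open>f\<close>, the same at all points of all charts of the atlas: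
  the row is the upper index and the column the lower index, so \<open>fcomp n ix *v x\<close> is \<open>f x\<close>.\<close>

definition fcomp :: "nat \<Rightarrow> (nat \<Rightarrow> 'd::finite) \<Rightarrow> real^'d^'d" where
  "fcomp n ix = (\<chi> \<alpha> \<beta>. if \<exists>k\<in>{1..n}. \<alpha> = ix (n + k) \<and> \<beta> = ix k then 1 else 0)"

section \<open>Vector fields, metrics and connections\<close>

text \<open>Geometric objects are given by their components in each chart of the atlas, as functions of the
  point, subject to the transformation law. In \<open>jac b c p\<close> the row is the index of the
  \<open>c\<close>-coordinate and the column that of the \<open>b\<close>-coordinate with respect to which it is
  differentiated.\<close>

definition jac :: "('p, 'd::finite) chart \<Rightarrow> ('p, 'd) chart \<Rightarrow> 'p \<Rightarrow> real^'d^'d" where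
  "jac b c p = (\<chi> \<alpha> \<beta>. pd \<beta> (\<lambda>x. transition b c x $ \<alpha>) (crd b p))"

definition smooth_in_chart ::
    "('p, 'd::finite) chart \<Rightarrow> ('p \<Rightarrow> 'b::real_normed_vector) \<Rightarrow> bool" where
  "smooth_in_chart c h \<longleftrightarrow> smooth_on (crd c ` dom_of c) (\<lambda>x. h (point_of c x))"

definition pd_in_chart :: "('p, 'd::finite) chart \<Rightarrow> 'd \<Rightarrow> ('p \<Rightarrow> real) \<Rightarrow> 'p \<Rightarrow> real" where
  "pd_in_chart c \<sigma> h p = pd \<sigma> (\<lambda>x. h (point_of c x)) (crd c p)"

definition vector_field ::
    "('p, 'd::finite) chart set \<Rightarrow> (('p, 'd) chart \<Rightarrow> 'p \<Rightarrow> real^'d) \<Rightarrow> bool" where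
  "vector_field A X \<longleftrightarrow>
     (\<forall>c\<in>A. smooth_in_chart c (X c)) \<and>
     (\<forall>b\<in>A. \<forall>c\<in>A. \<forall>p\<in>dom_of b \<inter> dom_of c. X c p = jac b c p *v X b p)"

text \<open>No condition is imposed on the signature of the metric.\<close>

definition pseudo_riemannian_metric ::
    "('p, 'd::finite) chart set \<Rightarrow> (('p, 'd) chart \<Rightarrow> 'p \<Rightarrow> real^'d^'d) \<Rightarrow> bool" where
  "pseudo_riemannian_metric A g \<longleftrightarrow>
     (\<forall>c\<in>A. smooth_in_chart c (g c)) \<and>
     (\<forall>c\<in>A. \<forall>p\<in>dom_of c. transpose (g c p) = g c p \<and> invertible (g c p)) \<and>
     (\<forall>b\<in>A. \<forall>c\<in>A. \<forall>p\<in>dom_of b \<inter> dom_of c.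
        g b p = transpose (jac b c p) ** g c p ** jac b c p)"

definition bilin :: "real^'d^'d \<Rightarrow> real^'d \<Rightarrow> real^'d \<Rightarrow> real" where
  "bilin B x y = (\<Sum>\<alpha>\<in>UNIV. \<Sum>\<beta>\<in>UNIV. B $ \<alpha> $ \<beta> * x $ \<alpha> * y $ \<beta>)"

definition B_type ::
    "nat \<Rightarrow> nat \<Rightarrow> (nat \<Rightarrow> 'd::finite) \<Rightarrow> 'p topology \<Rightarrow> ('p, 'd) chart set \<Rightarrow>
     (('p, 'd) chart \<Rightarrow> 'p \<Rightarrow> real^'d^'d) \<Rightarrow> bool" where
  "B_type n m ix M A g \<longleftrightarrow>
     adapted_manifold n m ix M A \<and> pseudo_riemannian_metric A g \<and>
     (\<forall>X Y. vector_field A X \<longrightarrow> vector_field A Y \<longrightarrow>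
        (\<forall>c\<in>A. \<forall>p\<in>dom_of c.
           bilin (g c p) (fcomp n ix *v X c p) (Y c p) =
           bilin (g c p) (X c p) (fcomp n ix *v Y c p)))"

text \<open>\<open>\<Gamma> c p \<sigma> \<alpha> \<beta>\<close> is the connection coefficient with upper index \<open>\<sigma>\<close> and lower indices \<open>\<alpha>\<close>, \<open>\<beta>\<close> in
  the chart \<open>c\<close> at \<open>p\<close>.\<close>

type_synonym ('p, 'd) conn_coeffs = "('p, 'd) chart \<Rightarrow> 'p \<Rightarrow> 'd \<Rightarrow> 'd \<Rightarrow> 'd \<Rightarrow> real"

definition linear_connection ::
    "('p, 'd::finite) chart set \<Rightarrow> ('p, 'd) conn_coeffs \<Rightarrow> bool" where
  "linear_connection A \<Gamma> \<longleftrightarrow>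
     (\<forall>c\<in>A. \<forall>\<sigma> \<alpha> \<beta>. smooth_in_chart c (\<lambda>p. \<Gamma> c p \<sigma> \<alpha> \<beta>)) \<and>
     (\<forall>b\<in>A. \<forall>c\<in>A. \<forall>p\<in>dom_of b \<inter> dom_of c. \<forall>\<sigma> \<kappa> \<mu>.
        (\<Sum>\<nu>\<in>UNIV. jac b c p $ \<sigma> $ \<nu> * \<Gamma> b p \<nu> \<kappa> \<mu>) =
        (\<Sum>\<alpha>\<in>UNIV. \<Sum>\<beta>\<in>UNIV. \<Gamma> c p \<sigma> \<alpha> \<beta> * jac b c p $ \<alpha> $ \<kappa> * jac b c p $ \<beta> $ \<mu>) +
        pd \<kappa> (pd \<mu> (\<lambda>x. transition b c x $ \<sigma>)) (crd b p))"

definition torsion_free :: "('p, 'd) chart set \<Rightarrow> ('p, 'd) conn_coeffs \<Rightarrow> bool" where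
  "torsion_free A \<Gamma> \<longleftrightarrow> (\<forall>c\<in>A. \<forall>p\<in>dom_of c. \<forall>\<sigma> \<alpha> \<beta>. \<Gamma> c p \<sigma> \<alpha> \<beta> = \<Gamma> c p \<sigma> \<beta> \<alpha>)"

definition metric_cov_deriv ::
    "(('p, 'd::finite) chart \<Rightarrow> 'p \<Rightarrow> real^'d^'d) \<Rightarrow> ('p, 'd) conn_coeffs \<Rightarrow>
     ('p, 'd) chart \<Rightarrow> 'p \<Rightarrow> 'd \<Rightarrow> 'd \<Rightarrow> 'd \<Rightarrow> real" where
  "metric_cov_deriv g \<Gamma> c p \<sigma> \<alpha> \<beta> =
     pd_in_chart c \<sigma> (\<lambda>q. g c q $ \<alpha> $ \<beta>) p
     - (\<Sum>\<kappa>\<in>UNIV. \<Gamma> c p \<kappa> \<sigma> \<alpha> * g c p $ \<kappa> $ \<beta>)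
     - (\<Sum>\<kappa>\<in>UNIV. \<Gamma> c p \<kappa> \<sigma> \<beta> * g c p $ \<alpha> $ \<kappa>)"

definition levi_civita ::
    "('p, 'd::finite) chart set \<Rightarrow> (('p, 'd) chart \<Rightarrow> 'p \<Rightarrow> real^'d^'d) \<Rightarrow>
     ('p, 'd) conn_coeffs \<Rightarrow> bool" where
  "levi_civita A g \<Gamma> \<longleftrightarrow>
     linear_connection A \<Gamma> \<and> torsion_free A \<Gamma> \<and>
     (\<forall>c\<in>A. \<forall>p\<in>dom_of c. \<forall>\<sigma> \<alpha> \<beta>. metric_cov_deriv g \<Gamma> c p \<sigma> \<alpha> \<beta> = 0)"

section \<open>Purity\<close>

definition pure_connection ::
    "nat \<Rightarrow> (nat \<Rightarrow> 'd::finite) \<Rightarrow> ('p, 'd) chart set \<Rightarrow> ('p, 'd) conn_coeffs \<Rightarrow> bool" where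
  "pure_connection n ix A \<Gamma> \<longleftrightarrow>
     (\<forall>c\<in>A. \<forall>p\<in>dom_of c. \<forall>\<alpha> \<beta> \<sigma>.
        (\<Sum>\<kappa>\<in>UNIV. \<Gamma> c p \<kappa> \<beta> \<sigma> * fcomp n ix $ \<alpha> $ \<kappa>) =
        (\<Sum>\<kappa>\<in>UNIV. \<Gamma> c p \<alpha> \<beta> \<kappa> * fcomp n ix $ \<kappa> $ \<sigma>) \<and>
        (\<Sum>\<kappa>\<in>UNIV. \<Gamma> c p \<alpha> \<beta> \<kappa> * fcomp n ix $ \<kappa> $ \<sigma>) =
        (\<Sum>\<kappa>\<in>UNIV. \<Gamma> c p \<alpha> \<kappa> \<sigma> * fcomp n ix $ \<kappa> $ \<beta>))"

definition pure_metric_derivatives ::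
    "nat \<Rightarrow> (nat \<Rightarrow> 'd::finite) \<Rightarrow> ('p, 'd) chart set \<Rightarrow>
     (('p, 'd) chart \<Rightarrow> 'p \<Rightarrow> real^'d^'d) \<Rightarrow> bool" where
  "pure_metric_derivatives n ix A g \<longleftrightarrow>
     (\<forall>c\<in>A. \<forall>p\<in>dom_of c. \<forall>\<alpha> \<beta> \<sigma>.
        (\<Sum>\<kappa>\<in>UNIV. fcomp n ix $ \<kappa> $ \<sigma> * pd_in_chart c \<kappa> (\<lambda>q. g c q $ \<alpha> $ \<beta>) p) =
        (\<Sum>\<kappa>\<in>UNIV. fcomp n ix $ \<kappa> $ \<alpha> * pd_in_chart c \<sigma> (\<lambda>q. g c q $ \<kappa> $ \<beta>) p) \<and>
        (\<Sum>\<kappa>\<in>UNIV. fcomp n ix $ \<kappa> $ \<alpha> * pd_in_chart c \<sigma> (\<lambda>q. g c q $ \<kappa> $ \<beta>) p) =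
        (\<Sum>\<kappa>\<in>UNIV. fcomp n ix $ \<kappa> $ \<beta> * pd_in_chart c \<sigma> (\<lambda>q. g c q $ \<alpha> $ \<kappa>) p))"

end

theory Submission
  imports Defs
begin

text \<open>Lowering the upper index of \<open>\<Gamma>\<close> with \<open>g\<close> preserves purity, because \<open>g\<close> itself is pure; after
  that, metric compatibility and the Koszul formula express \<open>\<partial>g\<close> and the lowered coefficients as
  linear combinations of index permutations of each other. The \<open>B\<close>-type condition speaks about
  globally defined vector fields only. To read it off at a point, every tangent vector is extended
  to a global vector field by a bump function with compact support in a chart; the extension by
  zero is smooth because compact sets are closed in a Hausdorff space.\<close>

section \<open>Smooth functions\<close>

text \<open>The coinductive \<open>smooth_on\<close> is awkward for closure under products and composition, whose
  derivatives are sums of several terms; the finite approximations below allow plain induction.\<close>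

primrec Ck_on ::
    "nat \<Rightarrow> 'a::real_normed_vector set \<Rightarrow> ('a \<Rightarrow> 'b::real_normed_vector) \<Rightarrow> bool" where
  "Ck_on 0 S h = True"
| "Ck_on (Suc k) S h \<longleftrightarrow>
     (\<exists>h'. (\<forall>x\<in>S. (h has_derivative h' x) (at x)) \<and> (\<forall>v. Ck_on k S (\<lambda>x. h' x v)))"

text \<open>Openness of \<open>S\<close> lets agreement on \<open>S\<close> pass to derivatives at
  its points. After that \<open>h\<close> and \<open>h1\<close> share the same \<open>h'\<close>, so
  a case distinction on \<open>k\<close> replaces an induction.\<close>

lemma Ck_on_cong:
  assumes "open S" "\<And>x. x \<in> S \<Longrightarrow> h x = h1 x" "Ck_on k S h"
  shows "Ck_on k S h1"
proof (cases k)
  case (Suc j)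
  then obtain h' where h': "\<And>x. x \<in> S \<Longrightarrow> (h has_derivative h' x) (at x)"
    and C: "\<And>v. Ck_on j S (\<lambda>x. h' x v)"
    using assms(3) by auto
  have "(h1 has_derivative h' x) (at x)" if "x \<in> S" for x
    using has_derivative_transform_within_open[OF h'[OF that] assms(1) that] assms(2) by blast
  then show ?thesis using Suc C by auto
qed simp

lemma Ck_on_subset: "Ck_on k S h \<Longrightarrow> T \<subseteq> S \<Longrightarrow> Ck_on k T h"
proof (induction k arbitrary: h)
  case (Suc k)
  then obtain h' where "\<And>x. x \<in> S \<Longrightarrow> (h has_derivative h' x) (at x)"
    "\<And>v. Ck_on k S (\<lambda>x. h' x v)"
    by auto
  then show ?case
    using Suc.prems(2) by (auto intro!: exI[of _ h'] Suc.IH)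
qed simp

lemma Ck_on_pred: "Ck_on (Suc k) S h \<Longrightarrow> Ck_on k S h"
proof (induction k arbitrary: h)
  case (Suc k)
  then show ?case by (metis Ck_on.simps(2))
qed simp

lemma smooth_on_iff_Ck_on:
  assumes "open S"
  shows "smooth_on S h \<longleftrightarrow> (\<forall>k. Ck_on k S h)"
proof
  assume "smooth_on S h"
  moreover have "smooth_on S h \<Longrightarrow> Ck_on k S h" for k
  proof (induction k arbitrary: h)
    case (Suc k)
    from Suc.prems show ?case
      by (cases rule: smooth_on.cases) (auto intro!: Suc.IH)
  qed simp
  ultimately show "\<forall>k. Ck_on k S h" by blast
next
  assume "\<forall>k. Ck_on k S h"
  then show "smooth_on S h"
  proof (coinduction arbitrary: h rule: smooth_on.coinduct)
    case (smooth_on h)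
    \<comment> \<open>Each order \<open>k\<close> may supply its own \<open>h'\<close>. Uniqueness
      of the derivative forces all of them to agree with \<open>D\<close> on \<open>S\<close>, which
      gives the single witness that coinduction asks for.\<close>
    define D where "D = (\<lambda>x. frechet_derivative h (at x))"
    have uniq: "h' = D x" if "(h has_derivative h') (at x)" for h' x
      unfolding D_def by (rule frechet_derivative_at[OF that])
    have "Ck_on (Suc 0) S h" using smooth_on by blast
    then have 1: "(h has_derivative D x) (at x)" if "x \<in> S" for x
      using uniq that by (simp del: Ck_on.simps(1)) metis
    have 2: "Ck_on k S (\<lambda>x. D x v)" for k v
    proof -
      have "Ck_on (Suc k) S h" using smooth_on by blast
      then obtain h' where h': "\<And>x. x \<in> S \<Longrightarrow> (h has_derivative h' x) (at x)"
        and C: "\<And>v. Ck_on k S (\<lambda>x. h' x v)"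
        by auto
      show ?thesis
        by (rule Ck_on_cong[OF assms _ C[of v]]) (use h' uniq in force)
    qed
    show ?case using 1 2 by blast
  qed
qed

section \<open>Closure properties of the finite approximations\<close>

lemma Ck_on_const: "Ck_on k S (\<lambda>x. c)"
proof (induction k arbitrary: c)
  case (Suc k)
  show ?case using Suc[of 0] by (auto intro!: exI[of _ "\<lambda>x v. 0"])
qed simp

lemma Ck_on_add: "Ck_on k S f \<Longrightarrow> Ck_on k S h \<Longrightarrow> Ck_on k S (\<lambda>x. f x + h x)"
proof (induction k arbitrary: f h)
  case (Suc k)
  obtain f' where f': "\<And>x. x \<in> S \<Longrightarrow> (f has_derivative f' x) (at x)" "\<And>v. Ck_on k S (\<lambda>x. f' x v)"
    using Suc.prems(1) by auto
  obtain h' where h': "\<And>x. x \<in> S \<Longrightarrow> (h has_derivative h' x) (at x)" "\<And>v. Ck_on k S (\<lambda>x. h' x v)"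
    using Suc.prems(2) by auto
  from f' h' show ?case
    by (auto intro!: exI[of _ "\<lambda>x v. f' x v + h' x v"] has_derivative_add Suc.IH)
qed simp

lemma Ck_on_sum:
  "finite I \<Longrightarrow> (\<And>i. i \<in> I \<Longrightarrow> Ck_on k S (f i)) \<Longrightarrow> Ck_on k S (\<lambda>x. \<Sum>i\<in>I. f i x)"
  by (induction I rule: finite_induct) (auto intro!: Ck_on_const Ck_on_add)

lemma Ck_on_bounded_linear:
  assumes "bounded_linear L"
  shows "Ck_on k S f \<Longrightarrow> Ck_on k S (\<lambda>x. L (f x))"
proof (induction k arbitrary: f)
  case (Suc k)
  then obtain f' where
    "\<And>x. x \<in> S \<Longrightarrow> (f has_derivative f' x) (at x)" "\<And>v. Ck_on k S (\<lambda>x. f' x v)"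
    by auto
  then show ?case
    by (auto intro!: exI[of _ "\<lambda>x v. L (f' x v)"] bounded_linear.has_derivative[OF assms] Suc.IH)
qed simp

lemma Ck_on_scaleR:
  "Ck_on k S f \<Longrightarrow> Ck_on k S h \<Longrightarrow> Ck_on k S (\<lambda>x. f x *\<^sub>R h x)"
proof (induction k arbitrary: f h)
  case (Suc k)
  obtain f' where f': "\<And>x. x \<in> S \<Longrightarrow> (f has_derivative f' x) (at x)" "\<And>v. Ck_on k S (\<lambda>x. f' x v)"
    using Suc.prems(1) by auto
  obtain h' where h': "\<And>x. x \<in> S \<Longrightarrow> (h has_derivative h' x) (at x)" "\<And>v. Ck_on k S (\<lambda>x. h' x v)"
    using Suc.prems(2) by auto
  \<comment> \<open>The product rule leaves one factor undifferentiated in each term, so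
    \<open>f\<close> and \<open>h\<close> themselves are needed at order \<open>k\<close>.\<close>
  have "Ck_on k S f" "Ck_on k S h" using Suc.prems Ck_on_pred by blast+
  with f' h' show ?case
    by (auto intro!: exI[of _ "\<lambda>x v. f x *\<^sub>R h' x v + f' x v *\<^sub>R h x"] has_derivative_scaleR
        Ck_on_add Suc.IH)
qed simp

text \<open>In the chain rule the direction \<open>f' x v\<close> fed to \<open>h'\<close> varies
  with \<open>x\<close>, while the induction hypothesis covers fixed directions only. Expanding it
  in a finite basis of the intermediate space gives a sum of products of a coordinate of
  \<open>f' x v\<close> with \<open>h' (f x) i\<close>, each within reach of the induction.\<close>

lemma Ck_on_compose:
  fixes f :: "'a::real_normed_vector \<Rightarrow> 'b::euclidean_space"
  shows "Ck_on k S f \<Longrightarrow> Ck_on k T h \<Longrightarrow> f ` S \<subseteq> T \<Longrightarrow> Ck_on k S (\<lambda>x. h (f x))"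
proof (induction k arbitrary: h)
  case (Suc k)
  obtain f' where f': "\<And>x. x \<in> S \<Longrightarrow> (f has_derivative f' x) (at x)" "\<And>v. Ck_on k S (\<lambda>x. f' x v)"
    using Suc.prems(1) by auto
  obtain h' where h': "\<And>x. x \<in> T \<Longrightarrow> (h has_derivative h' x) (at x)" "\<And>v. Ck_on k T (\<lambda>x. h' x v)"
    using Suc.prems(2) by auto
  have "((\<lambda>x. h (f x)) has_derivative
          (\<lambda>v. \<Sum>i\<in>Basis. (f' x v \<bullet> i) *\<^sub>R h' (f x) i)) (at x)" if "x \<in> S" for x
  proof -
    have fx: "f x \<in> T" using that Suc.prems(3) by blast
    have lin: "linear (h' (f x))"
      using h'(1)[OF fx] by (rule has_derivative_linear)
    have "h' (f x) w = (\<Sum>i\<in>Basis. (w \<bullet> i) *\<^sub>R h' (f x) i)" for w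
    proof -
      have "h' (f x) w = h' (f x) (\<Sum>i\<in>Basis. (w \<bullet> i) *\<^sub>R i)"
        by (simp add: euclidean_representation)
      also have "\<dots> = (\<Sum>i\<in>Basis. (w \<bullet> i) *\<^sub>R h' (f x) i)"
        by (simp add: linear_sum[OF lin] linear_cmul[OF lin])
      finally show ?thesis .
    qed
    then have "(\<lambda>v. h' (f x) (f' x v)) = (\<lambda>v. \<Sum>i\<in>Basis. (f' x v \<bullet> i) *\<^sub>R h' (f x) i)"
      by blast
    with has_derivative_compose[OF f'(1)[OF that] h'(1)[OF fx]] show ?thesis by (simp only:)
  qed
  moreover have "Ck_on k S (\<lambda>x. \<Sum>i\<in>Basis. (f' x v \<bullet> i) *\<^sub>R h' (f x) i)" for v
    by (intro Ck_on_sum Ck_on_scaleR Ck_on_bounded_linear[OF bounded_linear_inner_left] Suc.IH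
        finite_Basis Ck_on_pred[OF Suc.prems(1)] f'(2) h'(2) Suc.prems(3))
  ultimately show ?case
    by (auto intro!: exI[of _ "\<lambda>x v. \<Sum>i\<in>Basis. (f' x v \<bullet> i) *\<^sub>R h' (f x) i"])
qed simp

lemma Ck_on_Un:
  assumes "open S" "open T"
  shows "Ck_on k S h \<Longrightarrow> Ck_on k T h \<Longrightarrow> Ck_on k (S \<union> T) h"
proof (induction k arbitrary: h)
  case (Suc k)
  obtain a where a: "\<And>x. x \<in> S \<Longrightarrow> (h has_derivative a x) (at x)" "\<And>v. Ck_on k S (\<lambda>x. a x v)"
    using Suc.prems(1) by auto
  obtain b where b: "\<And>x. x \<in> T \<Longrightarrow> (h has_derivative b x) (at x)" "\<And>v. Ck_on k T (\<lambda>x. b x v)"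
    using Suc.prems(2) by auto
  \<comment> \<open>One derivative on the union; the preference for \<open>a\<close> is harmless,
    since \<open>a\<close> and \<open>b\<close> agree on the intersection.\<close>
  define d where "d x = (if x \<in> S then a x else b x)" for x
  have ab: "a x = b x" if "x \<in> S" "x \<in> T" for x
    using a(1) b(1) that has_derivative_unique by blast
  have "Ck_on k S (\<lambda>x. d x v)" for v
    by (rule Ck_on_cong[OF assms(1) _ a(2)[of v]]) (simp add: d_def)
  moreover have "Ck_on k T (\<lambda>x. d x v)" for v
    by (rule Ck_on_cong[OF assms(2) _ b(2)[of v]]) (simp add: d_def ab)
  ultimately show ?case
    using a(1) b(1) by (auto intro!: exI[of _ d] Suc.IH simp: d_def)
qed simp

section \<open>Transfer of the closure properties to \<open>smooth_on\<close>\<close>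

lemma smooth_on_cong:
  "open S \<Longrightarrow> (\<And>x. x \<in> S \<Longrightarrow> h x = h1 x) \<Longrightarrow> smooth_on S h \<Longrightarrow> smooth_on S h1"
  by (metis smooth_on_iff_Ck_on Ck_on_cong)

lemma smooth_on_subset: "open S \<Longrightarrow> open T \<Longrightarrow> T \<subseteq> S \<Longrightarrow> smooth_on S h \<Longrightarrow> smooth_on T h"
  by (metis smooth_on_iff_Ck_on Ck_on_subset)

lemma smooth_on_const: "open S \<Longrightarrow> smooth_on S (\<lambda>x. c)"
  by (simp add: smooth_on_iff_Ck_on Ck_on_const)

lemma smooth_on_scaleR:
  "open S \<Longrightarrow> smooth_on S f \<Longrightarrow> smooth_on S h \<Longrightarrow> smooth_on S (\<lambda>x. f x *\<^sub>R h x)"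
  by (simp add: smooth_on_iff_Ck_on Ck_on_scaleR)

lemma smooth_on_compose:
  fixes f :: "'a::real_normed_vector \<Rightarrow> 'b::euclidean_space"
  assumes "open S" "open T" "smooth_on S f" "smooth_on T h" "f ` S \<subseteq> T"
  shows "smooth_on S (\<lambda>x. h (f x))"
  using assms by (metis smooth_on_iff_Ck_on Ck_on_compose)

lemma smooth_on_Un:
  "open S \<Longrightarrow> open T \<Longrightarrow> smooth_on S h \<Longrightarrow> smooth_on T h \<Longrightarrow> smooth_on (S \<union> T) h"
  by (simp add: smooth_on_iff_Ck_on Ck_on_Un open_Un)

lemma smooth_onE:
  assumes "smooth_on S h"
  obtains h' where "\<And>x. x \<in> S \<Longrightarrow> (h has_derivative h' x) (at x)"
    and "\<And>v. smooth_on S (\<lambda>x. h' x v)"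
  using assms by (cases rule: smooth_on.cases) blast

section \<open>A smooth bump function\<close>

text \<open>The classical flat function exp(-1/t), extended by zero. The polynomial factor in 1/t
  makes the family closed under differentiation.\<close>

definition flat :: "real poly \<Rightarrow> real \<Rightarrow> real" where
  "flat P t = (if t > 0 then poly P (1 / t) * exp (- (1 / t)) else 0)"

lemma poly_times_exp_neg_tendsto_0: "((\<lambda>s::real. poly P s * exp (- s)) \<longlongrightarrow> 0) at_top"
proof -
  have "((\<lambda>s. \<Sum>i\<le>degree P. coeff P i * (s ^ i / exp s)) \<longlongrightarrow> (\<Sum>i\<le>degree P. coeff P i * 0)) at_top"
    by (intro tendsto_sum tendsto_mult tendsto_const tendsto_power_div_exp_0)
  then show ?thesis
    by (simp add: poly_altdef sum_distrib_right exp_minus divide_inverse mult.assoc)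
qed

text \<open>For t > 0, differentiating P(1/t) exp(-1/t) yields (1/t)^2 (P(1/t) - P'(1/t)) exp(-1/t);
  the factor \<open>[:0, 0, 1:]\<close> is the square of the variable. At 0 the exponential decay
  beats every polynomial in 1/t.\<close>

lemma DERIV_flat:
  "(flat P has_real_derivative flat ([:0, 0, 1:] * (P - pderiv P)) t) (at t)"
proof (rule linorder_cases[of t 0])
  assume "t < 0"
  have "(flat P has_real_derivative 0) (at t)"
    by (rule has_field_derivative_transform_within_open[of "\<lambda>_. 0" _ _ "{..<0}"])
      (use \<open>t < 0\<close> in \<open>auto simp: flat_def\<close>)
  then show ?thesis using \<open>t < 0\<close> by (simp add: flat_def)
next
  assume "t > 0"
  have "((\<lambda>t. poly P (1 / t) * exp (- (1 / t))) has_real_derivative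
          flat ([:0, 0, 1:] * (P - pderiv P)) t) (at t)"
    using \<open>t > 0\<close>
    by (auto intro!: derivative_eq_intros DERIV_chain2[OF poly_DERIV]
        simp: flat_def field_simps power2_eq_square)
  then show ?thesis
    by (rule has_field_derivative_transform_within_open[of _ _ _ "{0<..}"])
      (use \<open>t > 0\<close> in \<open>auto simp: flat_def\<close>)
next
  assume [simp]: "t = 0"
  have "((\<lambda>h. flat P h / h) \<longlongrightarrow> 0) (at_left 0)"
    by (rule tendsto_eventually) (auto simp: flat_def eventually_at_filter)
  moreover have "((\<lambda>h. flat P h / h) \<longlongrightarrow> 0) (at_right 0)"
  proof -
    \<comment> \<open>\<open>pCons 0 P\<close> multiplies \<open>P\<close> by its variable, which
      absorbs the division by \<open>h\<close> in the difference quotient.\<close>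
    have "((\<lambda>h::real. poly (pCons 0 P) (inverse h) * exp (- inverse h)) \<longlongrightarrow> 0) (at_right 0)"
      using filterlim_compose[OF poly_times_exp_neg_tendsto_0 filterlim_inverse_at_top_right] .
    then show ?thesis
      by (rule Lim_transform_eventually)
        (auto simp: flat_def eventually_at_filter field_simps)
  qed
  ultimately have "((\<lambda>h. flat P h / h) \<longlongrightarrow> 0) (at 0)"
    by (simp add: filterlim_at_split)
  then show ?thesis by (simp add: has_field_derivative_iff flat_def)
qed

lemma smooth_on_flat: "smooth_on UNIV (flat P)"
proof -
  \<comment> \<open>The constant \<open>c\<close> keeps the induction closed: the derivative in
    direction \<open>v\<close> is again of this form, with \<open>c * v\<close> in place of
    \<open>c\<close>.\<close>
  have "Ck_on k UNIV (\<lambda>t. c * flat P t)" for k c P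
  proof (induction k arbitrary: c P)
    case (Suc k)
    let ?Q = "[:0, 0, 1:] * (P - pderiv P)"
    have "((\<lambda>t. c * flat P t) has_derivative (\<lambda>v. (c * v) * flat ?Q x)) (at x)" for x
      using has_derivative_mult_right[OF DERIV_flat[of P x, unfolded has_field_derivative_def], of c]
      by (simp add: mult_ac del: mult_pCons_left)
    then show ?case
      unfolding Ck_on.simps by (intro exI[of _ "\<lambda>x v. (c * v) * flat ?Q x"] conjI ballI allI Suc.IH)
  qed simp
  from this[of _ 1] show ?thesis by (simp add: smooth_on_iff_Ck_on)
qed

lemma smooth_on_norm_diff_square:
  fixes y :: "'a::real_inner"
  shows "smooth_on UNIV (\<lambda>x. c - (x - y) \<bullet> (x - y))"
proof (rule smooth_on.intros)
  show "((\<lambda>x. c - (x - y) \<bullet> (x - y)) has_derivative (\<lambda>v. - (2 * ((x - y) \<bullet> v)))) (at x)" for x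
    by (auto intro!: derivative_eq_intros simp: inner_commute)
  show "smooth_on UNIV (\<lambda>x. - (2 * ((x - y) \<bullet> v)))" for v
    by (rule smooth_on.intros[where h' = "\<lambda>x w. - (2 * (w \<bullet> v))"])
      (auto intro!: derivative_eq_intros smooth_on_const)
qed

lemma smooth_bump:
  fixes y :: "'a::euclidean_space"
  assumes "r > 0"
  shows "\<exists>\<rho> :: 'a \<Rightarrow> real. smooth_on UNIV \<rho> \<and> \<rho> y = 1 \<and> (\<forall>x. x \<notin> cball y r \<longrightarrow> \<rho> x = 0)"
proof (intro exI conjI allI impI)
  \<comment> \<open>The argument of \<open>flat\<close> equals \<open>r\<^sup>2\<close> at
    \<open>y\<close>, so the constant polynomial normalizes the value there to 1; off the ball the
    argument is not positive. The inner product is smooth also at \<open>y\<close>, where the norm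
    would not be.\<close>
  let ?b = "\<lambda>x. flat [:exp (1 / r\<^sup>2):] (r\<^sup>2 - (x - y) \<bullet> (x - y))"
  show "smooth_on UNIV ?b"
    by (rule smooth_on_compose[OF _ _ smooth_on_norm_diff_square smooth_on_flat]) auto
  show "?b y = 1"
    using assms by (simp add: flat_def exp_minus)
  show "?b x = 0" if "x \<notin> cball y r" for x
  proof -
    have "r < norm (x - y)" using that by (simp add: dist_norm norm_minus_commute)
    then have "r\<^sup>2 \<le> (norm (x - y))\<^sup>2" using assms by (intro power_mono) auto
    then show ?thesis by (simp add: flat_def power2_norm_eq_inner)
  qed
qed

section \<open>Charts\<close>

lemma is_chart_inj: "is_chart M c \<Longrightarrow> inj_on (crd c) (dom_of c)"
  unfolding is_chart_def
  by (metis homeomorphic_imp_injective_map openin_subset topspace_subtopology_subset)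

lemma point_of_crd: "is_chart M c \<Longrightarrow> p \<in> dom_of c \<Longrightarrow> point_of c (crd c p) = p"
  by (simp add: point_of_def is_chart_inj)

lemma open_crd_image:
  assumes "is_chart M c" "openin M W"
  shows "open (crd c ` (dom_of c \<inter> W))"
proof -
  have "openin (subtopology M (dom_of c)) (dom_of c \<inter> W)"
    using assms(2) by (auto simp: openin_subtopology)
  moreover have "open_map (subtopology M (dom_of c)) (top_of_set (crd c ` dom_of c)) (crd c)"
    using assms(1) homeomorphic_imp_open_map is_chart_def by blast
  ultimately have "openin (top_of_set (crd c ` dom_of c)) (crd c ` (dom_of c \<inter> W))"
    by (simp add: open_map_def)
  then show ?thesis
    using assms(1) is_chart_def openin_open_trans by blast
qed

lemma open_overlap: "is_chart M b \<Longrightarrow> is_chart M c \<Longrightarrow> open (overlap b c)"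
  unfolding overlap_def by (rule open_crd_image) (auto simp: is_chart_def)

lemma transition_crd:
  "is_chart M b \<Longrightarrow> p \<in> dom_of b \<Longrightarrow> transition b c (crd b p) = crd c p"
  by (simp add: transition_def point_of_crd)

text \<open>On the coordinate image, \<open>point_of c\<close> coincides with the continuous inverse
  supplied by the homeomorphism, and continuous images of compact sets are compact.\<close>

lemma compactin_point_of_image:
  assumes "is_chart M c" "compact K" "K \<subseteq> crd c ` dom_of c"
  shows "compactin M (point_of c ` K)"
proof -
  let ?U = "subtopology M (dom_of c)" and ?V = "top_of_set (crd c ` dom_of c)"
  have sub: "dom_of c \<subseteq> topspace M" using assms(1) by (simp add: is_chart_def openin_subset)
  obtain h where h: "homeomorphic_maps ?U ?V (crd c) h"
    using assms(1) homeomorphic_map_maps is_chart_def by blast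
  have "point_of c x = h x" if "x \<in> crd c ` dom_of c" for x
    using that h sub point_of_crd[OF assms(1)] by (auto simp: homeomorphic_maps_def)
  then have "point_of c ` K = h ` K" using assms(3) by (auto intro!: image_cong)
  moreover have "compactin ?V K"
    using assms(2,3) by (simp add: compactin_subtopology)
  then have "compactin ?U (h ` K)"
    using h image_compactin homeomorphic_maps_def by metis
  ultimately show ?thesis by (simp add: compactin_subtopology)
qed

section \<open>Partial derivatives and Jacobians in terms of the Frechet derivative\<close>

lemma pd_eq_derivative:
  assumes "(h has_derivative D) (at x)"
  shows "pd k h x = D (axis k 1)"
proof -
  have 1: "((\<lambda>t. x + t *\<^sub>R axis k (1::real)) has_derivative (\<lambda>t. t *\<^sub>R axis k 1)) (at 0)"
    by (auto intro!: derivative_eq_intros)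
  have "((\<lambda>t. h (x + t *\<^sub>R axis k 1)) has_derivative (\<lambda>t. D (t *\<^sub>R axis k 1))) (at 0)"
    using has_derivative_compose[OF 1, of h D] assms by simp
  moreover have "D (t *\<^sub>R axis k 1) = D (axis k 1) * t" for t
    using linear_cmul[OF has_derivative_linear[OF assms]] by simp
  ultimately have "((\<lambda>t. h (x + t *\<^sub>R axis k 1)) has_real_derivative D (axis k 1)) (at 0)"
    by (simp add: has_field_derivative_def)
  then show ?thesis unfolding pd_def by (rule DERIV_imp_deriv)
qed

text \<open>Identifies \<open>jac\<close> with the matrix of the Frechet derivative, so that
  Jacobians can be handled by the chain rule without components.\<close>

lemma jac_mult_vector:
  assumes "(transition b c has_derivative D) (at (crd b p))"
  shows "jac b c p *v v = D v"
proof -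
  have "pd \<beta> (\<lambda>x. transition b c x $ \<alpha>) (crd b p) = D (axis \<beta> 1) $ \<alpha>" for \<alpha> \<beta>
    using pd_eq_derivative[OF bounded_linear.has_derivative[OF bounded_linear_vec_nth assms]]
    by simp
  then have "jac b c p = matrix D" by (simp add: jac_def matrix_def)
  then show ?thesis
    by (simp add: matrix_works has_derivative_linear[OF assms])
qed

section \<open>Vector fields with a prescribed value at a point\<close>

lemma jac_self:
  assumes "is_chart M c" "p \<in> dom_of c"
  shows "jac c c p *v v = v"
proof -
  have "open (crd c ` dom_of c)" using assms(1) by (simp add: is_chart_def)
  then have "(transition c c has_derivative (\<lambda>v. v)) (at (crd c p))"
    by (rule has_derivative_transform_within_open[OF has_derivative_ident])
      (use assms in \<open>auto simp: transition_crd\<close>)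
  then show ?thesis by (rule jac_mult_vector)
qed

lemma smooth_manifoldD:
  assumes "smooth_manifold M A" "b \<in> A" "c \<in> A"
  shows "is_chart M b" "smooth_on (overlap b c) (transition b c)"
  using assms by (auto simp: smooth_manifold_def)

text \<open>The chain rule for changes of charts; it yields the transformation law of the vector
  fields constructed below.\<close>

lemma jac_chain:
  assumes M: "smooth_manifold M A" and A: "a \<in> A" "b \<in> A" "c \<in> A"
    and p: "p \<in> dom_of a" "p \<in> dom_of b" "p \<in> dom_of c"
  shows "jac b c p *v (jac a b p *v v) = jac a c p *v v"
proof -
  note ch = smooth_manifoldD(1)[OF M A(1) A(1)] smooth_manifoldD(1)[OF M A(2) A(2)]
    smooth_manifoldD(1)[OF M A(3) A(3)]
  obtain D where D: "(transition a b has_derivative D) (at (crd a p))"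
    using smooth_manifoldD(2)[OF M A(1,2)] p by (auto simp: overlap_def elim!: smooth_onE)
  obtain E where E: "(transition b c has_derivative E) (at (crd b p))"
    using smooth_manifoldD(2)[OF M A(2,3)] p by (auto simp: overlap_def elim!: smooth_onE)
  have "((\<lambda>x. transition b c (transition a b x)) has_derivative (\<lambda>v. E (D v))) (at (crd a p))"
    by (rule has_derivative_compose[OF D]) (simp add: E transition_crd[OF ch(1) p(1)])
  \<comment> \<open>The composite agrees with \<open>transition a c\<close> on all of
    \<open>overlap a b\<close>, even outside \<open>dom_of c\<close>, because \<open>crd c\<close>
    is a total function.\<close>
  moreover have "open (overlap a b)" by (rule open_overlap[OF ch(1,2)])
  ultimately have "(transition a c has_derivative (\<lambda>v. E (D v))) (at (crd a p))"
    by (rule has_derivative_transform_within_open)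
      (use p ch in \<open>auto simp: overlap_def transition_crd\<close>)
  then show ?thesis
    by (simp add: jac_mult_vector[OF D] jac_mult_vector[OF E] jac_mult_vector)
qed

lemma vector_field_through:
  fixes A :: "('p, 'd::finite) chart set"
  assumes M: "smooth_manifold M A" and c: "c \<in> A" and p: "p \<in> dom_of c"
  obtains X where "vector_field A X" "X c p = v"
proof -
  note chart = smooth_manifoldD(1)[OF M _ c]
  have cc: "is_chart M c" by (rule chart[OF c])
  have "open (crd c ` dom_of c)" using cc by (simp add: is_chart_def)
  then obtain r where r: "r > 0" "cball (crd c p) r \<subseteq> crd c ` dom_of c"
    using p open_contains_cball by blast
  obtain \<rho> :: "real^'d \<Rightarrow> real" where \<rho>: "smooth_on UNIV \<rho>" "\<rho> (crd c p) = 1"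
      "\<And>x. x \<notin> cball (crd c p) r \<Longrightarrow> \<rho> x = 0"
    using smooth_bump[OF r(1), of "crd c p"] by blast
  \<comment> \<open>The field will vanish off \<open>K\<close>. As a compact set in a Hausdorff
    space \<open>K\<close> is closed, so its complement is an open set on which the extension by
    zero is smooth.\<close>
  define K where "K = point_of c ` cball (crd c p) r"
  have "closedin M K"
    using M compactin_point_of_image[OF cc compact_cball r(2)] compactin_imp_closedin
    unfolding K_def smooth_manifold_def by blast
  then have oK: "openin M (topspace M - K)" by blast
  \<comment> \<open>The constant vector \<open>v\<close> of chart \<open>c\<close>, damped by the
    bump function and carried to chart \<open>b\<close> by the Jacobian.\<close>
  define X :: "('p, 'd) chart \<Rightarrow> 'p \<Rightarrow> real^'d" where
    "X b q = (if q \<in> dom_of c then jac c b q *v (\<rho> (crd c q) *\<^sub>R v) else 0)" for b q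
  have "smooth_in_chart b (X b)" if b: "b \<in> A" for b
  proof -
    have cb: "is_chart M b" by (rule chart[OF b])
    obtain D where D: "\<And>x. x \<in> overlap c b \<Longrightarrow> (transition c b has_derivative D x) (at x)"
      and sD: "\<And>v. smooth_on (overlap c b) (\<lambda>x. D x v)"
      using smooth_manifoldD(2)[OF M c b] by (auto elim!: smooth_onE)
    note op = open_overlap[OF cb cc] open_overlap[OF cc cb]
    \<comment> \<open>Smoothness is first obtained in \<open>c\<close>-coordinates, then moved to
      \<open>b\<close>-coordinates by composing with \<open>transition b c\<close>.\<close>
    have "smooth_on (overlap c b) (\<lambda>y. \<rho> y *\<^sub>R D y v)"
      using op \<rho>(1) sD by (intro smooth_on_scaleR) (auto intro: smooth_on_subset[OF open_UNIV])
    then have "smooth_on (overlap b c) (\<lambda>x. \<rho> (transition b c x) *\<^sub>R D (transition b c x) v)"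
      using cb
      by (intro smooth_on_compose[OF op smooth_manifoldD(2)[OF M b c]])
        (auto simp: overlap_def transition_crd)
    then have 1: "smooth_on (overlap b c) (\<lambda>x. X b (point_of b x))"
    proof (rule smooth_on_cong[OF op(1), rotated])
      fix x assume "x \<in> overlap b c"
      then obtain q where q: "q \<in> dom_of b" "q \<in> dom_of c" "x = crd b q"
        by (auto simp: overlap_def)
      then have "jac c b q *v w = D (crd c q) w" for w
        by (intro jac_mult_vector D) (auto simp: overlap_def)
      then show "\<rho> (transition b c x) *\<^sub>R D (transition b c x) v = X b (point_of b x)"
        using q cb by (simp add: X_def transition_crd point_of_crd matrix_vector_mult_scaleR
            flip: matrix_scaleR_vector_ac)
    qed
    \<comment> \<open>Together with \<open>overlap b c\<close> this open set covers the image of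
      chart \<open>b\<close>, since \<open>K\<close> lies inside \<open>dom_of c\<close>.\<close>
    let ?V = "crd b ` (dom_of b \<inter> (topspace M - K))"
    have oV: "open ?V" by (rule open_crd_image[OF cb oK])
    have 2: "smooth_on ?V (\<lambda>x. X b (point_of b x))"
    proof (rule smooth_on_cong[OF oV _ smooth_on_const[OF oV]])
      fix x assume "x \<in> ?V"
      then obtain q where q: "q \<in> dom_of b" "q \<notin> K" "x = crd b q" by blast
      have "\<rho> (crd c q) = 0" if "q \<in> dom_of c"
      proof (rule \<rho>(3))
        show "crd c q \<notin> cball (crd c p) r"
          using q(2) that point_of_crd[OF cc that] unfolding K_def by (metis imageI)
      qed
      then show "0 = X b (point_of b x)"
        using q cb by (simp add: X_def point_of_crd)
    qed
    have "K \<subseteq> dom_of c"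
      using r(2) point_of_crd[OF cc] unfolding K_def by fastforce
    moreover have "dom_of b \<subseteq> topspace M" using cb by (simp add: is_chart_def openin_subset)
    ultimately have "overlap b c \<union> ?V = crd b ` dom_of b"
      unfolding overlap_def by blast
    with smooth_on_Un[OF op(1) oV 1 2] show ?thesis
      by (simp add: smooth_in_chart_def)
  qed
  \<comment> \<open>Inside \<open>dom_of c\<close> this is the chain rule through \<open>c\<close>;
    outside, both sides are zero.\<close>
  moreover have "X b' q = jac b b' q *v X b q"
    if "b \<in> A" "b' \<in> A" "q \<in> dom_of b \<inter> dom_of b'" for b b' q
    using that jac_chain[OF M c, of b b' q] by (auto simp: X_def)
  ultimately have "vector_field A X" unfolding vector_field_def by blast
  moreover have "X c p = v" using p \<rho>(2) jac_self[OF cc p] by (simp add: X_def)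
  ultimately show ?thesis by (rule that)
qed

section \<open>Purity\<close>

lemma bilin_axis:
  "bilin B x (axis \<beta> 1) = (\<Sum>\<alpha>\<in>UNIV. B $ \<alpha> $ \<beta> * x $ \<alpha>)"
  "bilin B (axis \<alpha> 1) y = (\<Sum>\<beta>\<in>UNIV. B $ \<alpha> $ \<beta> * y $ \<beta>)"
proof -
  have "(\<Sum>\<beta>'\<in>UNIV. B $ \<alpha> $ \<beta>' * x $ \<alpha> * axis \<beta> 1 $ \<beta>') = B $ \<alpha> $ \<beta> * x $ \<alpha>" for \<alpha>
    by (simp add: axis_def if_distrib cong: if_cong)
  then show "bilin B x (axis \<beta> 1) = (\<Sum>\<alpha>\<in>UNIV. B $ \<alpha> $ \<beta> * x $ \<alpha>)"
    by (simp add: bilin_def)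
  have "(\<Sum>\<beta>\<in>UNIV. B $ \<alpha>' $ \<beta> * axis \<alpha> 1 $ \<alpha>' * y $ \<beta>) =
      (if \<alpha>' = \<alpha> then \<Sum>\<beta>\<in>UNIV. B $ \<alpha> $ \<beta> * y $ \<beta> else 0)" for \<alpha>'
    by (simp add: axis_def)
  then show "bilin B (axis \<alpha> 1) y = (\<Sum>\<beta>\<in>UNIV. B $ \<alpha> $ \<beta> * y $ \<beta>)"
    by (simp add: bilin_def)
qed

text \<open>The condition on fields is tested on global fields that take coordinate basis vectors as
  values at \<open>p\<close>.\<close>

lemma B_type_pure:
  assumes B: "B_type n m ix M A g" and c: "c \<in> A" "p \<in> dom_of c"
  shows "(\<Sum>\<kappa>\<in>UNIV. g c p $ \<kappa> $ \<beta> * fcomp n ix $ \<kappa> $ \<alpha>) =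
    (\<Sum>\<kappa>\<in>UNIV. g c p $ \<alpha> $ \<kappa> * fcomp n ix $ \<kappa> $ \<beta>)"
proof -
  have M: "smooth_manifold M A" using B by (simp add: B_type_def adapted_manifold_def)
  obtain X where X: "vector_field A X" "X c p = axis \<alpha> 1"
    using vector_field_through[OF M c] by metis
  obtain Y where Y: "vector_field A Y" "Y c p = axis \<beta> 1"
    using vector_field_through[OF M c] by metis
  have "bilin (g c p) (fcomp n ix *v X c p) (Y c p) = bilin (g c p) (X c p) (fcomp n ix *v Y c p)"
    using B X(1) Y(1) c by (auto simp: B_type_def)
  then show ?thesis
    by (simp add: X(2) Y(2) bilin_axis matrix_vector_mult_basis column_def)
qed

section \<open>Index algebra at a single point\<close>

lemma invertible_sum_cancel:
  fixes G :: "real^'d^'d"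
  assumes "invertible G" "\<And>\<alpha>. (\<Sum>\<kappa>\<in>UNIV. G $ \<alpha> $ \<kappa> * x \<kappa>) = (\<Sum>\<kappa>\<in>UNIV. G $ \<alpha> $ \<kappa> * y \<kappa>)"
  shows "x \<kappa> = y \<kappa>"
proof -
  have "G *v (\<chi> \<kappa>. x \<kappa>) = G *v (\<chi> \<kappa>. y \<kappa>)"
    using assms(2) by (simp add: matrix_vector_mult_def)
  then have "(\<chi> \<kappa>. x \<kappa>) = (\<chi> \<kappa>. y \<kappa>)"
    using inj_matrix_vector_mult[OF assms(1)] by (simp add: inj_eq)
  then show ?thesis by (simp add: vec_eq_iff)
qed

text \<open>The algebraic core: \<open>D\<close> stands for the derivatives of the metric and enters
  only through \<open>compat\<close>, so no calculus is left.\<close>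

lemma pure_iff_pointwise:
  fixes G F :: "real^'d^'d" and \<Gamma> D :: "'d \<Rightarrow> 'd \<Rightarrow> 'd \<Rightarrow> real"
  assumes sym: "\<And>\<alpha> \<beta>. G $ \<alpha> $ \<beta> = G $ \<beta> $ \<alpha>"
    and inv: "invertible G"
    and pure: "\<And>\<alpha> \<beta>. (\<Sum>\<kappa>\<in>UNIV. G $ \<kappa> $ \<beta> * F $ \<kappa> $ \<alpha>) = (\<Sum>\<kappa>\<in>UNIV. G $ \<alpha> $ \<kappa> * F $ \<kappa> $ \<beta>)"
    and tor: "\<And>\<sigma> \<alpha> \<beta>. \<Gamma> \<sigma> \<alpha> \<beta> = \<Gamma> \<sigma> \<beta> \<alpha>"
    and compat: "\<And>\<sigma> \<alpha> \<beta>. D \<sigma> \<alpha> \<beta> - (\<Sum>\<kappa>\<in>UNIV. \<Gamma> \<kappa> \<sigma> \<alpha> * G $ \<kappa> $ \<beta>)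
        - (\<Sum>\<kappa>\<in>UNIV. \<Gamma> \<kappa> \<sigma> \<beta> * G $ \<alpha> $ \<kappa>) = 0"
  shows "(\<forall>\<alpha> \<beta> \<sigma>.
        (\<Sum>\<kappa>\<in>UNIV. \<Gamma> \<kappa> \<beta> \<sigma> * F $ \<alpha> $ \<kappa>) = (\<Sum>\<kappa>\<in>UNIV. \<Gamma> \<alpha> \<beta> \<kappa> * F $ \<kappa> $ \<sigma>) \<and>
        (\<Sum>\<kappa>\<in>UNIV. \<Gamma> \<alpha> \<beta> \<kappa> * F $ \<kappa> $ \<sigma>) = (\<Sum>\<kappa>\<in>UNIV. \<Gamma> \<alpha> \<kappa> \<sigma> * F $ \<kappa> $ \<beta>)) \<longleftrightarrow>
    (\<forall>\<alpha> \<beta> \<sigma>.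
        (\<Sum>\<kappa>\<in>UNIV. F $ \<kappa> $ \<sigma> * D \<kappa> \<alpha> \<beta>) = (\<Sum>\<kappa>\<in>UNIV. F $ \<kappa> $ \<alpha> * D \<sigma> \<kappa> \<beta>) \<and>
        (\<Sum>\<kappa>\<in>UNIV. F $ \<kappa> $ \<alpha> * D \<sigma> \<kappa> \<beta>) = (\<Sum>\<kappa>\<in>UNIV. F $ \<kappa> $ \<beta> * D \<sigma> \<alpha> \<kappa>))"
    (is "?P \<longleftrightarrow> ?Q")
proof -
  \<comment> \<open>The Christoffel symbols of the first kind, with the lowered index in first
    place.\<close>
  define L where "L \<alpha> \<beta> \<sigma> = (\<Sum>\<kappa>\<in>UNIV. G $ \<alpha> $ \<kappa> * \<Gamma> \<kappa> \<beta> \<sigma>)" for \<alpha> \<beta> \<sigma>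
  have L_sym: "L \<alpha> \<beta> \<sigma> = L \<alpha> \<sigma> \<beta>" for \<alpha> \<beta> \<sigma> unfolding L_def by (subst tor) (rule refl)
  have D_L: "D \<sigma> \<alpha> \<beta> = L \<beta> \<sigma> \<alpha> + L \<alpha> \<sigma> \<beta>" for \<sigma> \<alpha> \<beta>
    using compat[of \<sigma> \<alpha> \<beta>] by (simp add: L_def sym[of \<beta>] mult.commute)
  \<comment> \<open>The Koszul formula.\<close>
  have L_D: "L \<alpha> \<beta> \<sigma> = (D \<beta> \<alpha> \<sigma> + D \<sigma> \<alpha> \<beta> - D \<alpha> \<beta> \<sigma>) / 2" for \<alpha> \<beta> \<sigma>
    unfolding D_L using L_sym[of \<sigma> \<alpha> \<beta>] L_sym[of \<alpha> \<sigma> \<beta>] L_sym[of \<beta> \<alpha> \<sigma>] by simp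
  \<comment> \<open>The digit names the slot into which \<open>F\<close> is contracted; the first
    slot of \<open>D\<close> is the direction of differentiation.\<close>
  define L1 where "L1 \<alpha> \<beta> \<sigma> = (\<Sum>\<kappa>\<in>UNIV. F $ \<kappa> $ \<alpha> * L \<kappa> \<beta> \<sigma>)" for \<alpha> \<beta> \<sigma>
  define L2 where "L2 \<alpha> \<beta> \<sigma> = (\<Sum>\<kappa>\<in>UNIV. F $ \<kappa> $ \<beta> * L \<alpha> \<kappa> \<sigma>)" for \<alpha> \<beta> \<sigma>
  define L3 where "L3 \<alpha> \<beta> \<sigma> = (\<Sum>\<kappa>\<in>UNIV. F $ \<kappa> $ \<sigma> * L \<alpha> \<beta> \<kappa>)" for \<alpha> \<beta> \<sigma>
  define D1 where "D1 \<sigma> \<alpha> \<beta> = (\<Sum>\<kappa>\<in>UNIV. F $ \<kappa> $ \<sigma> * D \<kappa> \<alpha> \<beta>)" for \<sigma> \<alpha> \<beta>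
  define D2 where "D2 \<sigma> \<alpha> \<beta> = (\<Sum>\<kappa>\<in>UNIV. F $ \<kappa> $ \<alpha> * D \<sigma> \<kappa> \<beta>)" for \<sigma> \<alpha> \<beta>
  define D3 where "D3 \<sigma> \<alpha> \<beta> = (\<Sum>\<kappa>\<in>UNIV. F $ \<kappa> $ \<beta> * D \<sigma> \<alpha> \<kappa>)" for \<sigma> \<alpha> \<beta>
  have Ds: "D1 \<sigma> \<alpha> \<beta> = L2 \<beta> \<sigma> \<alpha> + L2 \<alpha> \<sigma> \<beta>" "D2 \<sigma> \<alpha> \<beta> = L3 \<beta> \<sigma> \<alpha> + L1 \<alpha> \<sigma> \<beta>"
    "D3 \<sigma> \<alpha> \<beta> = L1 \<beta> \<sigma> \<alpha> + L3 \<alpha> \<sigma> \<beta>" for \<sigma> \<alpha> \<beta>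
    by (simp_all add: D1_def D2_def D3_def L1_def L2_def L3_def D_L distrib_left sum.distrib)
  have Ls: "L1 \<alpha> \<beta> \<sigma> = (D2 \<beta> \<alpha> \<sigma> + D2 \<sigma> \<alpha> \<beta> - D1 \<alpha> \<beta> \<sigma>) / 2"
    "L2 \<alpha> \<beta> \<sigma> = (D1 \<beta> \<alpha> \<sigma> + D3 \<sigma> \<alpha> \<beta> - D2 \<alpha> \<beta> \<sigma>) / 2"
    "L3 \<alpha> \<beta> \<sigma> = (D3 \<beta> \<alpha> \<sigma> + D1 \<sigma> \<alpha> \<beta> - D3 \<alpha> \<beta> \<sigma>) / 2" for \<alpha> \<beta> \<sigma>
    by (simp_all add: D1_def D2_def D3_def L1_def L2_def L3_def L_D distrib_left sum.distrib
        right_diff_distrib sum_subtractf flip: sum_divide_distrib)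
  have L_swap: "L1 \<alpha> \<beta> \<sigma> = L1 \<alpha> \<sigma> \<beta>" "L2 \<alpha> \<beta> \<sigma> = L3 \<alpha> \<sigma> \<beta>" for \<alpha> \<beta> \<sigma>
    by (simp_all add: L1_def L2_def L3_def L_sym[of _ \<sigma>])
  \<comment> \<open>Here purity of the metric enters: it moves \<open>F\<close> from the upper index
    of the connection to the lowered one.\<close>
  have low1: "(\<Sum>\<mu>\<in>UNIV. G $ \<alpha> $ \<mu> * (\<Sum>\<kappa>\<in>UNIV. \<Gamma> \<kappa> \<beta> \<sigma> * F $ \<mu> $ \<kappa>)) = L1 \<alpha> \<beta> \<sigma>" for \<alpha> \<beta> \<sigma>
  proof -
    have "(\<Sum>\<mu>\<in>UNIV. G $ \<alpha> $ \<mu> * (\<Sum>\<kappa>\<in>UNIV. \<Gamma> \<kappa> \<beta> \<sigma> * F $ \<mu> $ \<kappa>)) =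
        (\<Sum>\<mu>\<in>UNIV. \<Sum>\<kappa>\<in>UNIV. \<Gamma> \<kappa> \<beta> \<sigma> * (G $ \<alpha> $ \<mu> * F $ \<mu> $ \<kappa>))"
      by (simp add: sum_distrib_left mult_ac)
    also have "\<dots> = (\<Sum>\<kappa>\<in>UNIV. \<Gamma> \<kappa> \<beta> \<sigma> * (\<Sum>\<mu>\<in>UNIV. G $ \<alpha> $ \<mu> * F $ \<mu> $ \<kappa>))"
      by (subst sum.swap) (simp add: sum_distrib_left)
    also have "\<dots> = (\<Sum>\<kappa>\<in>UNIV. \<Gamma> \<kappa> \<beta> \<sigma> * (\<Sum>\<mu>\<in>UNIV. G $ \<mu> $ \<kappa> * F $ \<mu> $ \<alpha>))"
      by (simp add: pure)
    also have "\<dots> = (\<Sum>\<mu>\<in>UNIV. \<Sum>\<kappa>\<in>UNIV. F $ \<mu> $ \<alpha> * (G $ \<mu> $ \<kappa> * \<Gamma> \<kappa> \<beta> \<sigma>))"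
      by (subst sum.swap) (simp add: sum_distrib_left mult_ac)
    finally show ?thesis by (simp add: L1_def L_def sum_distrib_left)
  qed
  have low3: "(\<Sum>\<mu>\<in>UNIV. G $ \<alpha> $ \<mu> * (\<Sum>\<kappa>\<in>UNIV. \<Gamma> \<mu> \<beta> \<kappa> * F $ \<kappa> $ \<sigma>)) = L3 \<alpha> \<beta> \<sigma>" for \<alpha> \<beta> \<sigma>
    unfolding L3_def L_def sum_distrib_left by (subst sum.swap) (simp add: mult_ac)
  have low2: "(\<Sum>\<mu>\<in>UNIV. G $ \<alpha> $ \<mu> * (\<Sum>\<kappa>\<in>UNIV. \<Gamma> \<mu> \<kappa> \<sigma> * F $ \<kappa> $ \<beta>)) = L2 \<alpha> \<beta> \<sigma>" for \<alpha> \<beta> \<sigma>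
    unfolding L2_def L_def sum_distrib_left by (subst sum.swap) (simp add: mult_ac)
  have "?P \<longleftrightarrow> (\<forall>\<alpha> \<beta> \<sigma>. L1 \<alpha> \<beta> \<sigma> = L3 \<alpha> \<beta> \<sigma> \<and> L3 \<alpha> \<beta> \<sigma> = L2 \<alpha> \<beta> \<sigma>)" (is "_ \<longleftrightarrow> ?PL")
  proof
    assume ?P
    then show ?PL by (simp flip: low1 low2 low3)
  next
    assume PL: ?PL
    show ?P
    \<comment> \<open>Invertibility of \<open>G\<close> raises the lowered index again.\<close>
    proof (intro allI conjI)
      fix \<alpha> \<beta> \<sigma>
      show "(\<Sum>\<kappa>\<in>UNIV. \<Gamma> \<kappa> \<beta> \<sigma> * F $ \<alpha> $ \<kappa>) = (\<Sum>\<kappa>\<in>UNIV. \<Gamma> \<alpha> \<beta> \<kappa> * F $ \<kappa> $ \<sigma>)"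
        by (rule invertible_sum_cancel[OF inv, where \<kappa> = \<alpha>]) (use PL in \<open>simp add: low1 low3\<close>)
      show "(\<Sum>\<kappa>\<in>UNIV. \<Gamma> \<alpha> \<beta> \<kappa> * F $ \<kappa> $ \<sigma>) = (\<Sum>\<kappa>\<in>UNIV. \<Gamma> \<alpha> \<kappa> \<sigma> * F $ \<kappa> $ \<beta>)"
        by (rule invertible_sum_cancel[OF inv, where \<kappa> = \<alpha>]) (use PL in \<open>simp add: low2 low3\<close>)
    qed
  qed
  also have "\<dots> \<longleftrightarrow> (\<forall>\<alpha> \<beta> \<sigma>. D1 \<sigma> \<alpha> \<beta> = D2 \<sigma> \<alpha> \<beta> \<and> D2 \<sigma> \<alpha> \<beta> = D3 \<sigma> \<alpha> \<beta>)" (is "_ \<longleftrightarrow> ?QL")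
  proof
    assume PL: ?PL
    \<comment> \<open>With a single contraction left, the three right-hand sides of
      \<open>Ds\<close> become identical; the converse treats \<open>Ls\<close> likewise.\<close>
    then have "L2 = L1" "L3 = L1" by (simp_all add: fun_eq_iff)
    then show ?QL using L_swap by (simp add: Ds)
  next
    assume ?QL
    then have "D2 = D1" "D3 = D1" by (simp_all add: fun_eq_iff)
    then show ?PL by (simp add: Ls)
  qed
  finally show ?thesis by (simp add: D1_def D2_def D3_def)
qed

theorem theorem3:
  fixes n m :: nat
    and ix :: "nat \<Rightarrow> 'd::finite"
    and M :: "'p topology"
    and A :: "('p, 'd) chart set"
    and g :: "('p, 'd) chart \<Rightarrow> 'p \<Rightarrow> real^'d^'d"
    and \<Gamma> :: "('p, 'd) conn_coeffs"
  assumes "B_type n m ix M A g"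
    and "levi_civita A g \<Gamma>"
  shows "pure_connection n ix A \<Gamma> \<longleftrightarrow> pure_metric_derivatives n ix A g"
proof -
  \<comment> \<open>The two purity conditions are already equivalent at each point of each
    chart.\<close>
  have "(\<forall>\<alpha> \<beta> \<sigma>.
        (\<Sum>\<kappa>\<in>UNIV. \<Gamma> c p \<kappa> \<beta> \<sigma> * fcomp n ix $ \<alpha> $ \<kappa>) =
        (\<Sum>\<kappa>\<in>UNIV. \<Gamma> c p \<alpha> \<beta> \<kappa> * fcomp n ix $ \<kappa> $ \<sigma>) \<and>
        (\<Sum>\<kappa>\<in>UNIV. \<Gamma> c p \<alpha> \<beta> \<kappa> * fcomp n ix $ \<kappa> $ \<sigma>) =
        (\<Sum>\<kappa>\<in>UNIV. \<Gamma> c p \<alpha> \<kappa> \<sigma> * fcomp n ix $ \<kappa> $ \<beta>)) \<longleftrightarrow>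
    (\<forall>\<alpha> \<beta> \<sigma>.
        (\<Sum>\<kappa>\<in>UNIV. fcomp n ix $ \<kappa> $ \<sigma> * pd_in_chart c \<kappa> (\<lambda>q. g c q $ \<alpha> $ \<beta>) p) =
        (\<Sum>\<kappa>\<in>UNIV. fcomp n ix $ \<kappa> $ \<alpha> * pd_in_chart c \<sigma> (\<lambda>q. g c q $ \<kappa> $ \<beta>) p) \<and>
        (\<Sum>\<kappa>\<in>UNIV. fcomp n ix $ \<kappa> $ \<alpha> * pd_in_chart c \<sigma> (\<lambda>q. g c q $ \<kappa> $ \<beta>) p) =
        (\<Sum>\<kappa>\<in>UNIV. fcomp n ix $ \<kappa> $ \<beta> * pd_in_chart c \<sigma> (\<lambda>q. g c q $ \<alpha> $ \<kappa>) p))"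
    if c: "c \<in> A" "p \<in> dom_of c" for c p
  proof (rule pure_iff_pointwise[where G = "g c p" and F = "fcomp n ix" and \<Gamma> = "\<Gamma> c p"
        and D = "\<lambda>\<sigma> \<alpha> \<beta>. pd_in_chart c \<sigma> (\<lambda>q. g c q $ \<alpha> $ \<beta>) p"])
    have g: "transpose (g c p) = g c p" "invertible (g c p)"
      using assms(1) c unfolding B_type_def pseudo_riemannian_metric_def by blast+
    show "invertible (g c p)" by (fact g)
    show "g c p $ \<alpha> $ \<beta> = g c p $ \<beta> $ \<alpha>" for \<alpha> \<beta>
      by (subst g(1)[symmetric]) (simp add: transpose_def)
    show "(\<Sum>\<kappa>\<in>UNIV. g c p $ \<kappa> $ \<beta> * fcomp n ix $ \<kappa> $ \<alpha>) =
        (\<Sum>\<kappa>\<in>UNIV. g c p $ \<alpha> $ \<kappa> * fcomp n ix $ \<kappa> $ \<beta>)" for \<alpha> \<beta>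
      by (rule B_type_pure[OF assms(1) c])
    show "\<Gamma> c p \<sigma> \<alpha> \<beta> = \<Gamma> c p \<sigma> \<beta> \<alpha>" for \<sigma> \<alpha> \<beta>
      using assms(2) c unfolding levi_civita_def torsion_free_def by blast
    show "pd_in_chart c \<sigma> (\<lambda>q. g c q $ \<alpha> $ \<beta>) p - (\<Sum>\<kappa>\<in>UNIV. \<Gamma> c p \<kappa> \<sigma> \<alpha> * g c p $ \<kappa> $ \<beta>)
        - (\<Sum>\<kappa>\<in>UNIV. \<Gamma> c p \<kappa> \<sigma> \<beta> * g c p $ \<alpha> $ \<kappa>) = 0" for \<sigma> \<alpha> \<beta>
      using assms(2) c unfolding levi_civita_def metric_cov_deriv_def by blast
  qed
  then show ?thesis
    unfolding pure_connection_def pure_metric_derivatives_def by blast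
qed

end
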